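(* Let $I$ be an ideal of a commutative ring $R$. Then $I$ is a lifting ideal of $R$ if and only if its radical $\sqrt{I}$ is a lifting ideal of $R$.
   Context: All rings are commutative with $1$. An ideal $I$ of a ring $R$ is called a lifting ideal of $R$ if the canonical ring map $R\rightarrow R/I$ lifts idempotents, i.e., every idempotent of $R/I$ is the image of an idempotent of $R$; equivalently, whenever $f\in R$ satisfies $f-f^{2}\in I$, there exists an idempotent $e\in R$ with $f-e\in I$. *)

theory Defs
  imports "HOL-Algebra.QuotRing"
begin

definition idempotents :: "('a, 'b) ring_scheme \<Rightarrow> 'a set"
  where "idempotents R = {e \<in> carrier R. e \<otimes>\<^bsub>R\<^esub> e = e}"

definition radical :: "('a, 'b) ring_scheme \<Rightarrow> 'a set \<Rightarrow> 'a set"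
  where "radical R I = {x \<in> carrier R. \<exists>n::nat. n > 0 \<and> x [^]\<^bsub>R\<^esub> n \<in> I}"

(* The canonical ring map R -> R Quot I sends e to the coset I +> e. *)
definition lifting_ideal :: "'a set \<Rightarrow> ('a, 'b) ring_scheme \<Rightarrow> bool"
  where "lifting_ideal I R \<longleftrightarrow>
    ideal I R \<and> (\<forall>E \<in> idempotents (R Quot I). \<exists>e \<in> idempotents R. I +>\<^bsub>R\<^esub> e = E)"

lemma (in cring) lifting_ideal_iff_elementwise:
  assumes "ideal I R"
  shows "lifting_ideal I R \<longleftrightarrow>
    (\<forall>f \<in> carrier R. f \<ominus> f \<otimes> f \<in> I \<longrightarrow> (\<exists>e \<in> idempotents R. f \<ominus> e \<in> I))"
proof -
  interpret I: ideal I R by (rule assms)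
  have coset_eq: "I +> a = I +> b \<longleftrightarrow> a \<ominus> b \<in> I"
    if "a \<in> carrier R" "b \<in> carrier R" for a b
    using quotient_eq_iff_same_a_r_cos[OF assms that] by blast
  have coset_idem: "I +> f \<in> idempotents (R Quot I) \<longleftrightarrow> f \<ominus> f \<otimes> f \<in> I"
    if "f \<in> carrier R" for f
  proof -
    have "I +> f \<in> carrier (R Quot I)"
      using that by (auto simp: FactRing_def A_RCOSETS_def')
    then have "I +> f \<in> idempotents (R Quot I) \<longleftrightarrow> I +> f \<otimes> f = I +> f"
      using I.rcoset_mult_add[OF that that] by (simp add: idempotents_def FactRing_def)
    also have "\<dots> \<longleftrightarrow> f \<ominus> f \<otimes> f \<in> I"
      using coset_eq[of f "f \<otimes> f"] that by (metis m_closed)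
    finally show ?thesis .
  qed
  have all_cosets: "E \<in> idempotents (R Quot I) \<Longrightarrow> \<exists>f \<in> carrier R. E = I +> f" for E
    unfolding idempotents_def by (auto simp: FactRing_def A_RCOSETS_def')
  have lift: "(\<exists>e \<in> idempotents R. I +> e = I +> f) \<longleftrightarrow> (\<exists>e \<in> idempotents R. f \<ominus> e \<in> I)"
    if "f \<in> carrier R" for f
    using coset_eq[OF that] unfolding idempotents_def by (metis (no_types, lifting) mem_Collect_eq)
  show ?thesis
  proof
    assume L: "lifting_ideal I R"
    show "\<forall>f \<in> carrier R. f \<ominus> f \<otimes> f \<in> I \<longrightarrow> (\<exists>e \<in> idempotents R. f \<ominus> e \<in> I)"
    proof (intro ballI impI)
      fix f assume f: "f \<in> carrier R" "f \<ominus> f \<otimes> f \<in> I"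
      then have "I +> f \<in> idempotents (R Quot I)" by (simp add: coset_idem)
      with L have "\<exists>e \<in> idempotents R. I +> e = I +> f"
        unfolding lifting_ideal_def by (elim conjE) (drule (1) bspec)
      then show "\<exists>e \<in> idempotents R. f \<ominus> e \<in> I" by (simp only: lift[OF f(1)])
    qed
  next
    assume E: "\<forall>f \<in> carrier R. f \<ominus> f \<otimes> f \<in> I \<longrightarrow> (\<exists>e \<in> idempotents R. f \<ominus> e \<in> I)"
    show "lifting_ideal I R"
      unfolding lifting_ideal_def
    proof (intro conjI ballI)
      show "ideal I R" by (rule assms)
      fix A assume A: "A \<in> idempotents (R Quot I)"
      from all_cosets[OF A] obtain f where f: "f \<in> carrier R" "A = I +> f" by blast
      with A have "f \<ominus> f \<otimes> f \<in> I" by (simp only: coset_idem)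
      with E f(1) have "\<exists>e \<in> idempotents R. f \<ominus> e \<in> I" by blast
      then show "\<exists>e \<in> idempotents R. I +> e = A" by (simp only: f(2) lift[OF f(1)])
    qed
  qed
qed

lemma (in cring) radical_ideal:
  assumes "ideal I R"
  shows "ideal (radical R I) R"
proof -
  interpret I: ideal I R by (rule assms)
  have mono: "x [^] k \<in> I" if "x \<in> carrier R" "x [^] m \<in> I" "m \<le> k" for x and m k :: nat
    using that I.I_l_closed[of "x [^] m" "x [^] (k - m)"] by (simp add: nat_pow_mult)
  have add_pow: "(x \<oplus> y) [^] k \<otimes> (x [^] i \<otimes> y [^] j) \<in> I"
    if "x \<in> carrier R" "y \<in> carrier R" "x [^] m \<in> I" "y [^] n \<in> I" "m + n \<le> k + i + j"
    for x y and m n k i j :: nat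
    using that(5)
  proof (induction k arbitrary: i j)
    case 0
    then have "m \<le> i \<or> n \<le> j" by linarith
    then have "x [^] i \<in> I \<or> y [^] j \<in> I" using mono that by blast
    then show ?case using that by (auto simp: I.I_l_closed I.I_r_closed)
  next
    case (Suc k)
    have "(x \<oplus> y) [^] Suc k \<otimes> (x [^] i \<otimes> y [^] j) =
      (x \<oplus> y) [^] k \<otimes> (x [^] Suc i \<otimes> y [^] j) \<oplus> (x \<oplus> y) [^] k \<otimes> (x [^] i \<otimes> y [^] Suc j)"
    proof -
      define p q r where "p = (x \<oplus> y) [^] k" and "q = x [^] i" and "r = y [^] j"
      have "p \<in> carrier R" "q \<in> carrier R" "r \<in> carrier R"
        using that by (auto simp: p_def q_def r_def)
      then have "(p \<otimes> (x \<oplus> y)) \<otimes> (q \<otimes> r) = p \<otimes> ((q \<otimes> x) \<otimes> r) \<oplus> p \<otimes> (q \<otimes> (r \<otimes> y))"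
        using that by algebra
      then show ?thesis by (simp add: p_def q_def r_def)
    qed
    moreover have "(x \<oplus> y) [^] k \<otimes> (x [^] Suc i \<otimes> y [^] j) \<in> I"
      "(x \<oplus> y) [^] k \<otimes> (x [^] i \<otimes> y [^] Suc j) \<in> I"
      using Suc.IH[of "Suc i" j] Suc.IH[of i "Suc j"] Suc.prems by simp_all
    ultimately show ?case by (simp add: I.a_closed)
  qed
  have smult: "a \<otimes> x \<in> radical R I" if "x \<in> radical R I" "a \<in> carrier R" for a x
    using that by (auto simp: radical_def nat_pow_distrib I.I_l_closed)
  show ?thesis
  proof (rule idealI)
    show "ring R" by (rule ring_axioms)
    show "subgroup (radical R I) (add_monoid R)"
    proof (rule add.subgroupI)
      show "radical R I \<subseteq> carrier R" by (auto simp: radical_def)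
      have "\<zero> [^] (1::nat) \<in> I" by simp
      then show "radical R I \<noteq> {}" unfolding radical_def using zero_closed zero_less_one by blast
      show "\<ominus> x \<in> radical R I" if "x \<in> radical R I" for x
        using smult[OF that, of "\<ominus> \<one>"] that by (auto simp: radical_def l_minus)
      show "x \<oplus> y \<in> radical R I" if "x \<in> radical R I" "y \<in> radical R I" for x y
      proof -
        from that obtain m n :: nat where "m > 0" "x [^] m \<in> I" "y [^] n \<in> I"
          and "x \<in> carrier R" "y \<in> carrier R"
          by (auto simp: radical_def)
        then have "(x \<oplus> y) [^] (m + n) \<in> I"
          using add_pow[of x y m n "m + n" 0 0] by simp
        then show ?thesis using \<open>m > 0\<close> \<open>x \<in> carrier R\<close> \<open>y \<in> carrier R\<close>
          unfolding radical_def by blast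
      qed
    qed
    show "a \<otimes> x \<in> radical R I" if "x \<in> radical R I" "a \<in> carrier R" for a x
      by (rule smult[OF that])
    show "x \<otimes> a \<in> radical R I" if "x \<in> radical R I" "a \<in> carrier R" for a x
      using smult[OF that] that by (simp add: radical_def m_comm)
  qed
qed

end

(* Newton's iteration g |-> 3 g^2 - 2 g^3 turns an element f that is idempotent modulo the radical
   of I into one that is idempotent modulo I without changing its class modulo the radical, so
   lifting modulo I gives lifting modulo the radical. Conversely, an element of the radical of I that
   is idempotent modulo I lies in I. If f is idempotent modulo I and e is an idempotent congruent
   to f modulo the radical, this applies to f (1 - e) and e (1 - f), whose difference is f - e. *)
theory Submission
  imports Defs
begin

context cring
begin

lemma subset_radical:
  assumes "ideal I R"
  shows "I \<subseteq> radical R I"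
proof
  interpret ideal I R by (rule assms)
  fix x assume "x \<in> I"
  then have "x \<in> carrier R" "x [^] (1::nat) \<in> I" by simp_all
  then show "x \<in> radical R I" unfolding radical_def using zero_less_one by blast
qed

text \<open>With h = g^2 (3 - 2g), both h and 1 - h = (1 - g)^2 (1 + 2g) carry a square, so h (1 -
  h) is divisible by the square of g (1 - g): a Newton step squares the defect g - g^2, up to a
  cofactor.\<close>

lemma newton_step_defect:
  assumes g: "g \<in> carrier R"
  shows "(g \<otimes> g \<otimes> (\<one> \<oplus> \<one> \<oplus> \<one> \<ominus> g \<ominus> g)) \<ominus>
      (g \<otimes> g \<otimes> (\<one> \<oplus> \<one> \<oplus> \<one> \<ominus> g \<ominus> g)) \<otimes> (g \<otimes> g \<otimes> (\<one> \<oplus> \<one> \<oplus> \<one> \<ominus> g \<ominus> g)) =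
    (g \<ominus> g \<otimes> g) \<otimes> (g \<ominus> g \<otimes> g) \<otimes> ((\<one> \<oplus> \<one> \<oplus> \<one> \<ominus> g \<ominus> g) \<otimes> (\<one> \<oplus> g \<oplus> g))"
    (is "?h \<ominus> _ = _ \<otimes> _ \<otimes> (?t \<otimes> ?u)")
proof -
  have "?h \<ominus> ?h \<otimes> ?h = ?h \<otimes> (\<one> \<ominus> ?h)"
    using g by (simp add: r_distr r_minus a_minus_def)
  also have "\<one> \<ominus> ?h = (\<one> \<ominus> g) \<otimes> (\<one> \<ominus> g) \<otimes> ?u"
    using g by algebra
  \<comment> \<open>Used with y = 1 - g: each factor g is paired with a factor 1 - g.\<close>
  also have "g \<otimes> g \<otimes> t \<otimes> (y \<otimes> y \<otimes> u) = (g \<otimes> y) \<otimes> (g \<otimes> y) \<otimes> (t \<otimes> u)"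
    if "y \<in> carrier R" "t \<in> carrier R" "u \<in> carrier R" for y t u
    using that g by algebra
  also have "g \<otimes> (\<one> \<ominus> g) = g \<ominus> g \<otimes> g"
    using g by algebra
  finally show ?thesis using g by simp
qed

text \<open>A Newton step moves g only by a multiple of its defect, which keeps all iterates
  congruent to f modulo f - f^2.\<close>

lemma newton_step_diff:
  assumes "g \<in> carrier R"
  shows "g \<ominus> g \<otimes> g \<otimes> (\<one> \<oplus> \<one> \<oplus> \<one> \<ominus> g \<ominus> g) = (g \<ominus> g \<otimes> g) \<otimes> (\<one> \<ominus> g \<ominus> g)"
  using assms by algebra

text \<open>Explicit multiples instead of membership in an ideal let one g serve two ideals: the
  power of f - f^2 will lie in I, while f - f^2 itself lies only in the radical. The induction
  starts at g = f and applies a Newton step each time.\<close>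

lemma approximate_idempotent:
  fixes k :: nat
  assumes f: "f \<in> carrier R"
  shows "\<exists>g \<in> carrier R. \<exists>c \<in> carrier R. \<exists>d \<in> carrier R.
    g \<ominus> g \<otimes> g = (f \<ominus> f \<otimes> f) [^] Suc k \<otimes> c \<and> f \<ominus> g = (f \<ominus> f \<otimes> f) \<otimes> d"
proof (induction k)
  case 0
  have "f \<ominus> f = \<zero>" using f by algebra
  then have "f \<ominus> f \<otimes> f = (f \<ominus> f \<otimes> f) [^] Suc 0 \<otimes> \<one> \<and> f \<ominus> f = (f \<ominus> f \<otimes> f) \<otimes> \<zero>"
    using f by simp
  then show ?case using f by blast
next
  case (Suc k)
  define x where "x = f \<ominus> f \<otimes> f"
  define p where "p = x [^] k"
  have xp: "x \<in> carrier R" "p \<in> carrier R" using f by (simp_all add: x_def p_def)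
  from Suc obtain g c d where g: "g \<in> carrier R" and c: "c \<in> carrier R" and d: "d \<in> carrier R"
    and gc: "g \<ominus> g \<otimes> g = p \<otimes> x \<otimes> c" and gd: "f \<ominus> g = x \<otimes> d"
    unfolding x_def[symmetric] by (auto simp: p_def)
  define t where "t = \<one> \<oplus> \<one> \<oplus> \<one> \<ominus> g \<ominus> g"
  define h where "h = g \<otimes> g \<otimes> t"
  have t: "t \<in> carrier R" and h: "h \<in> carrier R" using g by (simp_all add: t_def h_def)
  define u where "u = \<one> \<oplus> g \<oplus> g"
  have u: "u \<in> carrier R" using g by (simp add: u_def)
  have "h \<ominus> h \<otimes> h = (p \<otimes> x \<otimes> c) \<otimes> (p \<otimes> x \<otimes> c) \<otimes> (t \<otimes> u)"
    unfolding h_def t_def u_def newton_step_defect[OF g] gc ..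
  \<comment> \<open>Squaring the defect gives more than is needed: one more factor x is kept, so
    that \<open>p \<otimes> x \<otimes> x\<close> is the required power, and the second p goes into
    the cofactor.\<close>
  also have "\<dots> = (p \<otimes> x \<otimes> x) \<otimes> (p \<otimes> c \<otimes> c \<otimes> (t \<otimes> u))"
    using xp c t u by algebra
  finally have 1: "h \<ominus> h \<otimes> h = x [^] Suc (Suc k) \<otimes> (p \<otimes> c \<otimes> c \<otimes> (t \<otimes> u))"
    by (simp add: p_def)
  have "f \<ominus> h = (f \<ominus> g) \<oplus> (g \<ominus> h)" using f g h by algebra
  also have "\<dots> = x \<otimes> d \<oplus> p \<otimes> x \<otimes> c \<otimes> (\<one> \<ominus> g \<ominus> g)"
    unfolding gd h_def t_def newton_step_diff[OF g] gc ..
  also have "\<dots> = x \<otimes> (d \<oplus> p \<otimes> c \<otimes> (\<one> \<ominus> g \<ominus> g))"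
    using xp c d g by algebra
  finally have 2: "f \<ominus> h = x \<otimes> (d \<oplus> p \<otimes> c \<otimes> (\<one> \<ominus> g \<ominus> g))" .
  have "p \<otimes> c \<otimes> c \<otimes> (t \<otimes> u) \<in> carrier R" "d \<oplus> p \<otimes> c \<otimes> (\<one> \<ominus> g \<ominus> g) \<in> carrier R"
    using xp c d t u g by simp_all
  with 1 2 h show ?case unfolding x_def[symmetric] by blast
qed

text \<open>Modulo I all positive powers of x agree, and one of them vanishes. The induction lowers
  the exponent by one at a time.\<close>

lemma mem_ideal_of_radical:
  assumes "ideal I R" and "x \<in> radical R I" and idem: "x \<ominus> x \<otimes> x \<in> I"
  shows "x \<in> I"
proof -
  interpret I: ideal I R by (rule assms(1))
  from assms(2) obtain n :: nat where x: "x \<in> carrier R" and "x [^] Suc n \<in> I"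
    unfolding radical_def by (auto simp: gr0_conv_Suc)
  from this(2) show ?thesis
  proof (induction n)
    case 0
    then show ?case using x by simp
  next
    case (Suc n)
    define p where "p = x [^] n"
    have p: "p \<in> carrier R" using x by (simp add: p_def)
    have "x [^] Suc n = p \<otimes> x" by (simp add: p_def)
    \<comment> \<open>The first summand is a multiple of x - x^2, and the second is the next higher
      power of x, already in I.\<close>
    also have "\<dots> = p \<otimes> (x \<ominus> x \<otimes> x) \<oplus> p \<otimes> x \<otimes> x"
      using x p by algebra
    also have "\<dots> \<in> I"
      using Suc.prems p idem by (simp add: p_def I.I_l_closed)
    finally show ?case by (rule Suc.IH)
  qed
qed

lemma lifting_ideal_radical:
  assumes I: "ideal I R" and L: "lifting_ideal I R"
  shows "lifting_ideal (radical R I) R"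
  unfolding lifting_ideal_iff_elementwise[OF radical_ideal[OF I]]
proof (intro ballI impI)
  interpret I: ideal I R by (rule I)
  interpret J: ideal "radical R I" R by (rule radical_ideal[OF I])
  fix f assume f: "f \<in> carrier R" and x: "f \<ominus> f \<otimes> f \<in> radical R I"
  \<comment> \<open>The exponent that brings the defect of f into I fixes how far to
    iterate.\<close>
  then obtain k :: nat where k: "(f \<ominus> f \<otimes> f) [^] Suc k \<in> I"
    unfolding radical_def by (auto simp: gr0_conv_Suc)
  from approximate_idempotent[OF f, of k] obtain g c d
    where g: "g \<in> carrier R" and c: "c \<in> carrier R" and d: "d \<in> carrier R"
      and gc: "g \<ominus> g \<otimes> g = (f \<ominus> f \<otimes> f) [^] Suc k \<otimes> c" and gd: "f \<ominus> g = (f \<ominus> f \<otimes> f) \<otimes> d"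
    by blast
  have "g \<ominus> g \<otimes> g \<in> I" unfolding gc by (rule I.I_r_closed[OF k c])
  with L g obtain e where e: "e \<in> idempotents R" "g \<ominus> e \<in> I"
    unfolding lifting_ideal_iff_elementwise[OF I] by blast
  have "f \<ominus> g \<in> radical R I" unfolding gd by (rule J.I_r_closed[OF x d])
  moreover have "g \<ominus> e \<in> radical R I" using e(2) subset_radical[OF I] by blast
  moreover have "f \<ominus> e = (f \<ominus> g) \<oplus> (g \<ominus> e)"
  proof -
    have "e \<in> carrier R" using e(1) by (simp add: idempotents_def)
    then show ?thesis using f g by algebra
  qed
  ultimately have "f \<ominus> e \<in> radical R I" by (simp add: J.a_closed)
  with e(1) show "\<exists>e \<in> idempotents R. f \<ominus> e \<in> radical R I" by blast
qed

lemma lifting_ideal_of_radical: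
  assumes I: "ideal I R" and L: "lifting_ideal (radical R I) R"
  shows "lifting_ideal I R"
  unfolding lifting_ideal_iff_elementwise[OF I]
proof (intro ballI impI)
  interpret I: ideal I R by (rule I)
  fix f assume f: "f \<in> carrier R" and fI: "f \<ominus> f \<otimes> f \<in> I"
  with subset_radical[OF I] L obtain e
    where e: "e \<in> idempotents R" and fe: "f \<ominus> e \<in> radical R I"
    unfolding lifting_ideal_iff_elementwise[OF radical_ideal[OF I]] by blast
  have eR: "e \<in> carrier R" "e \<otimes> e = e" using e by (simp_all add: idempotents_def)
  interpret J: ideal "radical R I" R by (rule radical_ideal[OF I])
  define c where "c = \<one> \<ominus> e"
  have c: "c \<in> carrier R" using eR(1) by (simp add: c_def)
  have ec: "e \<otimes> c = \<zero>"
    using eR by (simp add: c_def a_minus_def r_distr r_minus r_neg)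
  have "c \<otimes> c = c \<ominus> e \<otimes> c"
    unfolding c_def using eR(1) by algebra
  then have cc: "c \<otimes> c = c" using c by (simp add: ec a_minus_def)
  \<comment> \<open>Since e c = 0, the element f c is a multiple of f - e.\<close>
  have "f \<otimes> c = (f \<ominus> e) \<otimes> c \<oplus> e \<otimes> c"
    using f eR(1) c by algebra
  then have "f \<otimes> c \<in> radical R I"
    using f fe eR(1) c by (simp add: ec J.I_r_closed)
  \<comment> \<open>As c is idempotent, the defect of f c is c times the defect of f.\<close>
  moreover have "f \<otimes> c \<ominus> (f \<otimes> f) \<otimes> (c \<otimes> c) = (f \<ominus> f \<otimes> f) \<otimes> c"
    unfolding cc using f c by algebra
  then have "f \<otimes> c \<ominus> (f \<otimes> c) \<otimes> (f \<otimes> c) = (f \<ominus> f \<otimes> f) \<otimes> c"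
    using f c by (simp add: m_ac)
  then have "f \<otimes> c \<ominus> (f \<otimes> c) \<otimes> (f \<otimes> c) \<in> I"
    using fI c by (simp add: I.I_r_closed)
  ultimately have u: "f \<otimes> c \<in> I" by (rule mem_ideal_of_radical[OF I])
  \<comment> \<open>Writing e as e^2 turns e (1 - f) into a multiple of f - e as well.\<close>
  have "e \<otimes> e \<ominus> e \<otimes> f = (f \<ominus> e) \<otimes> \<ominus> e"
    using f eR(1) by algebra
  then have "e \<otimes> (\<one> \<ominus> f) = (f \<ominus> e) \<otimes> \<ominus> e"
    using f eR by (simp add: a_minus_def r_distr r_minus)
  then have "e \<otimes> (\<one> \<ominus> f) \<in> radical R I"
    using fe eR(1) by (simp add: J.I_r_closed)
  \<comment> \<open>The elements f and 1 - f have the same defect, and e is idempotent.\<close>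
  moreover have "e \<otimes> (\<one> \<ominus> f) \<ominus> (e \<otimes> e) \<otimes> ((\<one> \<ominus> f) \<otimes> (\<one> \<ominus> f)) = e \<otimes> (f \<ominus> f \<otimes> f)"
    unfolding eR(2) using f eR(1) by algebra
  then have "e \<otimes> (\<one> \<ominus> f) \<ominus> (e \<otimes> (\<one> \<ominus> f)) \<otimes> (e \<otimes> (\<one> \<ominus> f)) = e \<otimes> (f \<ominus> f \<otimes> f)"
    using f eR(1) by (simp add: m_ac)
  then have "e \<otimes> (\<one> \<ominus> f) \<ominus> (e \<otimes> (\<one> \<ominus> f)) \<otimes> (e \<otimes> (\<one> \<ominus> f)) \<in> I"
    using fI eR(1) by (simp add: I.I_l_closed)
  ultimately have v: "e \<otimes> (\<one> \<ominus> f) \<in> I" by (rule mem_ideal_of_radical[OF I])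
  \<comment> \<open>The products e f cancel in the difference.\<close>
  have "f \<ominus> e = f \<otimes> c \<ominus> e \<otimes> (\<one> \<ominus> f)"
    unfolding c_def using f eR(1) by algebra
  with u v have "f \<ominus> e \<in> I" by (simp add: a_minus_def)
  with e show "\<exists>e \<in> idempotents R. f \<ominus> e \<in> I" by blast
qed

end

theorem corollary3p2:
  fixes R :: "('a, 'b) ring_scheme" and I :: "'a set"
  assumes "cring R" and "ideal I R"
  shows "lifting_ideal I R \<longleftrightarrow> lifting_ideal (radical R I) R"
  using cring.lifting_ideal_radical[OF assms] cring.lifting_ideal_of_radical[OF assms] by blast

end
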